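(* Let $A(z)$ and $B(z)$ be polynomials in $z$ with complex coefficients, and let $(H_m(z))_{m\ge 0}$ be the sequence of polynomials defined by the generating function $$\sum_{m=0}^{\infty}H_{m}(z)t^{m}=\frac{1}{1+B(z)t+A(z)t^{2}}.$$ Let $\mathcal{C}_2$ be the set of all $z\in\mathbb{C}$ with $A(z)\neq 0$ such that $$\Im\frac{B^{2}(z)}{A(z)}=0\qquad\text{and}\qquad 0\le\Re\frac{B^{2}(z)}{A(z)}\le 4.$$ Then for every $m$, each root $z$ of $H_m$ with $A(z)\ne 0$ lies in $\mathcal{C}_2$. Moreover, these roots are dense in $\mathcal{C}_2$ as $m\to\infty$: for every $p\in\mathcal{C}_2$ and every open neighborhood $U$ of $p$ in $\mathbb{C}$, for all sufficiently large $m$ the polynomial $H_m$ has a root $z\in U$ with $A(z)\neq 0$.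
   Context: The generating function identity is one of formal power series in $t$ with coefficients in $\mathbb{C}[z]$. $\Re$ and $\Im$ denote real and imaginary parts. $B^2(z)$ means $(B(z))^2$.
   Formalization: The density claim is proved only when it is not the case that A is nonzero and B^2 = cA for a real constant c in [0,4]; in those cases it is false (e.g. A = B = 1, where C_2 is the whole plane but H_{3k} = 1 has no roots). *)

theory Defs
  imports Complex_Main "HOL-Computational_Algebra.Computational_Algebra"
begin

text \<open>
  Since \<^typ>\<open>complex poly\<close> is not a division ring, the identity
  \<open>(\<Sum>m. H m * t ^ m) = 1 / (1 + B * t + A * t ^ 2)\<close> in \<open>\<complex>[z][[t]]\<close> is expressed by
  multiplying out. The constant coefficient of the denominator is a unit, so this determines
  the sequence \<open>H\<close> uniquely.
\<close>
definition has_generating_function ::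
    "(nat \<Rightarrow> complex poly) \<Rightarrow> complex poly \<Rightarrow> complex poly \<Rightarrow> bool" where
  "has_generating_function H A B \<longleftrightarrow>
     Abs_fps H * (1 + fps_const B * fps_X + fps_const A * fps_X ^ 2) = 1"

definition C2 :: "complex poly \<Rightarrow> complex poly \<Rightarrow> complex set" where
  "C2 A B = {z. poly A z \<noteq> 0 \<and>
                Im ((poly B z)\<^sup>2 / poly A z) = 0 \<and>
                0 \<le> Re ((poly B z)\<^sup>2 / poly A z) \<and>
                Re ((poly B z)\<^sup>2 / poly A z) \<le> 4}"

text \<open>
  The quotient \<open>B\<^sup>2 / A\<close> is a constant in the interval \<open>[0, 4]\<close>. Then \<open>C2 A B\<close> is not a curve
  but the whole plane minus the roots of \<open>A\<close>, and for infinitely many \<open>m\<close> the polynomial \<open>H m\<close>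
  has no root outside the roots of \<open>A\<close>, so that density of the roots fails (for example
  \<open>A = B = 1\<close>, where \<open>H m = 1\<close> whenever \<open>m\<close> is a multiple of \<open>3\<close>).
\<close>
definition degenerate :: "complex poly \<Rightarrow> complex poly \<Rightarrow> bool" where
  "degenerate A B \<longleftrightarrow>
     A \<noteq> 0 \<and> (\<exists>c::real. 0 \<le> c \<and> c \<le> 4 \<and> B\<^sup>2 = smult (complex_of_real c) A)"

end

theory Submission
  imports Defs "HOL-Complex_Analysis.Complex_Analysis"
begin

text \<open>
  Fix \<open>z\<close> with \<open>A(z) \<noteq> 0\<close> and write \<open>1 + B(z) t + A(z) t\<^sup>2 = (1 - \<alpha> t) (1 - \<beta> t)\<close>. Partial
  fractions give \<open>(\<alpha> - \<beta>) H\<^sub>m(z) = \<alpha>\<^bsup>m+1\<^esup> - \<beta>\<^bsup>m+1\<^esup>\<close>, so that \<open>H\<^sub>m(z) = 0\<close> exactly when the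
  ratio \<open>r = \<alpha> / \<beta>\<close> is an \<open>(m+1)\<close>-st root of unity other than \<open>1\<close>. Since
  \<open>B\<^sup>2 / A = (\<alpha> + \<beta>)\<^sup>2 / (\<alpha> \<beta>) = 2 + r + 1/r\<close>, the vanishing of \<open>H\<^sub>m\<close> is a condition on
  \<open>B(z)\<^sup>2 / A(z)\<close> alone (\<open>recurrence_zero_iff\<close>): this quotient must be one of the real numbers
  \<open>2 + 2 cos (2\<pi>k/(m+1))\<close> with \<open>1 \<le> k \<le> m\<close>. They all lie in \<open>[0, 4]\<close>, which is the inclusion of
  the roots in the curve.

  For the density, these numbers approximate every point of \<open>[0, 4]\<close> as \<open>m\<close> grows
  (\<open>root_of_unity_values_dense\<close>). If \<open>B\<^sup>2 / A\<close> is not constant, it is an open map near a point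
  \<open>p\<close> of the curve (\<open>quotient_image_contains_ball\<close>), so it attains near \<open>p\<close> all values close to
  its value at \<open>p\<close>, and in particular one of these numbers once \<open>m\<close> is large. A constant
  quotient with a point on the curve is the degenerate case.
\<close>

lemma generating_function_recurrence:
  assumes "has_generating_function H A B"
  shows "H 0 = 1" "H (Suc 0) = - B" "H (Suc (Suc n)) = - B * H (Suc n) - A * H n"
proof -
  let ?F = "Abs_fps H"
  have eq: "?F + fps_const B * (?F * fps_X) + fps_const A * (?F * fps_X ^ 2) = 1"
    using assms unfolding has_generating_function_def by (simp add: algebra_simps)
  have coeff: "fps_nth (?F + fps_const B * (?F * fps_X) + fps_const A * (?F * fps_X ^ 2)) k
      = fps_nth 1 k" for k
    by (simp only: eq)
  show H0: "H 0 = 1"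
    using coeff[of 0] by (simp add: fps_X_power_mult_right_nth)
  show "H (Suc 0) = - B"
    using coeff[of "Suc 0"] H0 by (simp add: fps_X_power_mult_right_nth eq_neg_iff_add_eq_0)
  show "H (Suc (Suc n)) = - B * H (Suc n) - A * H n"
    using coeff[of "Suc (Suc n)"]
    by (simp add: fps_X_power_mult_right_nth algebra_simps(1-3) eq_diff_eq eq_neg_iff_add_eq_0)
qed

lemma complex_quadratic_factors:
  fixes a b :: complex
  obtains \<alpha> \<beta> where "\<alpha> + \<beta> = - b" "\<alpha> * \<beta> = a"
proof
  let ?s = "csqrt (b\<^sup>2 - 4 * a)"
  have s: "?s * ?s = b\<^sup>2 - 4 * a"
    using power2_csqrt[of "b\<^sup>2 - 4 * a"] by (simp add: power2_eq_square)
  show "(- b + ?s) / 2 + (- b - ?s) / 2 = - b"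
    by (simp add: field_simps)
  show "(- b + ?s) / 2 * ((- b - ?s) / 2) = a"
    using s by (simp add: field_simps power2_eq_square)
qed

lemma recurrence_closed_form:
  fixes u :: "nat \<Rightarrow> 'a :: comm_ring_1"
  assumes "u 0 = 1" "u (Suc 0) = \<alpha> + \<beta>"
    and "\<And>n. u (Suc (Suc n)) = (\<alpha> + \<beta>) * u (Suc n) - \<alpha> * \<beta> * u n"
  shows "(\<alpha> - \<beta>) * u n = \<alpha> ^ Suc n - \<beta> ^ Suc n"
proof (induction n rule: induct_nat_012)
  case (ge2 n)
  have "(\<alpha> - \<beta>) * u (Suc (Suc n))
      = (\<alpha> + \<beta>) * ((\<alpha> - \<beta>) * u (Suc n)) - \<alpha> * \<beta> * ((\<alpha> - \<beta>) * u n)"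
    by (simp add: assms(3) algebra_simps)
  then show ?case
    by (simp only: ge2) (simp add: algebra_simps)
qed (simp_all add: assms algebra_simps)

lemma recurrence_closed_form_double:
  fixes u :: "nat \<Rightarrow> 'a :: comm_ring_1"
  assumes "u 0 = 1" "u (Suc 0) = 2 * \<alpha>"
    and "\<And>n. u (Suc (Suc n)) = 2 * \<alpha> * u (Suc n) - \<alpha> * \<alpha> * u n"
  shows "u n = of_nat (Suc n) * \<alpha> ^ n"
  by (induction n rule: induct_nat_012) (simp_all add: assms algebra_simps)

text \<open>
  The number \<open>r\<close> is the ratio of the two characteristic roots. The value \<open>r = 1\<close> is excluded
  because a double root \<open>\<alpha>\<close> gives \<open>u m = (m + 1) \<alpha>\<^sup>m \<noteq> 0\<close>. The passage back from \<open>b\<^sup>2 / a\<close> to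
  the ratio is ambiguous only up to \<open>r \<mapsto> 1/r\<close>, that is, up to exchanging the roots.
\<close>

lemma recurrence_zero_iff:
  fixes u :: "nat \<Rightarrow> complex" and a b :: complex
  assumes u: "u 0 = 1" "u (Suc 0) = - b"
    "\<And>n. u (Suc (Suc n)) = - b * u (Suc n) - a * u n"
    and a: "a \<noteq> 0"
  shows "u m = 0 \<longleftrightarrow> (\<exists>r. r ^ Suc m = 1 \<and> r \<noteq> 1 \<and> b\<^sup>2 / a = 2 + r + inverse r)"
proof -
  obtain \<alpha> \<beta> where sum: "\<alpha> + \<beta> = - b" and prod: "\<alpha> * \<beta> = a"
    by (rule complex_quadratic_factors)
  have nz: "\<alpha> \<noteq> 0" "\<beta> \<noteq> 0"
    using prod a by auto
  have closed: "(\<alpha> - \<beta>) * u m = \<alpha> ^ Suc m - \<beta> ^ Suc m"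
    by (rule recurrence_closed_form) (simp_all add: u sum prod)
  have b2: "b\<^sup>2 = (\<alpha> + \<beta>)\<^sup>2"
    by (simp add: sum)
  show ?thesis
  proof
    assume zero: "u m = 0"
    have "\<alpha> \<noteq> \<beta>"
    proof
      assume eq: "\<alpha> = \<beta>"
      have "u m = of_nat (Suc m) * \<alpha> ^ m"
        by (rule recurrence_closed_form_double) (use sum prod eq in \<open>simp_all add: u\<close>)
      then show False
        using zero nz by (simp del: of_nat_Suc)
    qed
    moreover have "\<alpha> ^ Suc m = \<beta> ^ Suc m"
      using closed zero by simp
    moreover have "b\<^sup>2 / a = 2 + \<alpha> / \<beta> + inverse (\<alpha> / \<beta>)"
      using nz unfolding b2 prod[symmetric] by (simp add: field_simps power2_eq_square)
    ultimately show "\<exists>r. r ^ Suc m = 1 \<and> r \<noteq> 1 \<and> b\<^sup>2 / a = 2 + r + inverse r"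
      using nz by (intro exI[of _ "\<alpha> / \<beta>"]) (simp add: power_divide del: power_Suc)
  next
    assume "\<exists>r. r ^ Suc m = 1 \<and> r \<noteq> 1 \<and> b\<^sup>2 / a = 2 + r + inverse r"
    then obtain r where r: "r ^ Suc m = 1" "r \<noteq> 1" "b\<^sup>2 / a = 2 + r + inverse r"
      by blast
    have "r \<noteq> 0"
      using r(1) by auto
    then have "r * (\<alpha> + \<beta>)\<^sup>2 = (2 * r + r * r + 1) * (\<alpha> * \<beta>)"
      using r(3) a unfolding b2 prod by (simp add: field_simps)
    then have "(\<alpha> - r * \<beta>) * (r * \<alpha> - \<beta>) = 0"
      by (simp add: algebra_simps power2_eq_square)
    then consider "\<alpha> = r * \<beta>" | "\<beta> = r * \<alpha>"
      by auto
    then have "\<alpha> ^ Suc m = \<beta> ^ Suc m \<and> \<alpha> \<noteq> \<beta>"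
      by cases (use r nz in \<open>simp_all add: power_mult_distrib del: power_Suc\<close>)
    then show "u m = 0"
      using closed by simp
  qed
qed

lemma generating_function_zero_iff:
  assumes "has_generating_function H A B" "poly A z \<noteq> 0"
  shows "poly (H m) z = 0 \<longleftrightarrow>
    (\<exists>r. r ^ Suc m = 1 \<and> r \<noteq> 1 \<and> (poly B z)\<^sup>2 / poly A z = 2 + r + inverse r)"
  by (rule recurrence_zero_iff[of "\<lambda>n. poly (H n) z"])
     (simp_all add: generating_function_recurrence[OF assms(1)] assms(2))

lemma two_plus_root_of_unity_real:
  fixes r :: complex
  assumes "r ^ Suc m = 1"
  shows "Im (2 + r + inverse r) = 0" "0 \<le> Re (2 + r + inverse r)" "Re (2 + r + inverse r) \<le> 4"
proof -
  have n: "norm r = 1"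
    using assms power_eq_1_iff by blast
  then have "inverse r = cnj r"
    by (intro inverse_unique) (simp add: complex_norm_square[symmetric])
  then show "Im (2 + r + inverse r) = 0" "0 \<le> Re (2 + r + inverse r)"
    "Re (2 + r + inverse r) \<le> 4"
    using abs_Re_le_cmod[of r] n by auto
qed

text \<open>
  With \<open>c = 2 + 2 cos \<theta>\<close> and \<open>\<theta> \<in> [0, \<pi>]\<close>, the angle \<open>\<theta>\<close> is approximated by the next larger
  multiple of \<open>2\<pi> / (m + 1)\<close>. Rounding up strictly keeps the root of unity away from \<open>1\<close> when
  \<open>\<theta> = 0\<close>, and \<open>\<theta> \<le> \<pi>\<close> leaves room below \<open>2\<pi>\<close>.
\<close>

lemma root_of_unity_values_dense:
  fixes c e :: real
  assumes c: "0 \<le> c" "c \<le> 4" and e: "0 < e"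
  shows "\<forall>\<^sub>F m in sequentially. \<exists>r::complex. r ^ Suc m = 1 \<and> r \<noteq> 1 \<and>
           dist (complex_of_real c) (2 + r + inverse r) < e"
proof -
  define \<theta> where "\<theta> = arccos ((c - 2) / 2)"
  have cos_\<theta>: "cos \<theta> = (c - 2) / 2" and \<theta>: "0 \<le> \<theta>" "\<theta> \<le> pi"
    using c by (auto simp: \<theta>_def intro!: cos_arccos arccos_lbound arccos_ubound)
  define k where "k m = \<lfloor>\<theta> * real (Suc m) / (2 * pi)\<rfloor> + 1" for m
  define \<phi> where "\<phi> m = 2 * pi * real_of_int (k m) / real (Suc m)" for m
  have lower: "\<theta> < \<phi> m" for m
  proof -
    have "\<theta> * real (Suc m) / (2 * pi) < real_of_int (k m)"
      unfolding k_def by linarith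
    then show ?thesis
      by (simp add: \<phi>_def field_simps del: of_nat_Suc)
  qed
  have upper: "\<phi> m \<le> \<theta> + 2 * pi / real (Suc m)" for m
  proof -
    have "real_of_int (k m) \<le> \<theta> * real (Suc m) / (2 * pi) + 1"
      unfolding k_def by linarith
    then have "2 * pi * real_of_int (k m) \<le> 2 * pi * (\<theta> * real (Suc m) / (2 * pi) + 1)"
      by (intro mult_left_mono) auto
    also have "\<dots> = \<theta> * real (Suc m) + 2 * pi"
      by (simp add: field_simps del: of_nat_Suc)
    finally show ?thesis
      by (simp add: \<phi>_def field_simps del: of_nat_Suc)
  qed
  have "(\<lambda>m. 2 * pi / real (Suc m)) \<longlonglongrightarrow> 0"
    by (rule LIMSEQ_Suc[OF lim_const_over_n])
  then have "(\<lambda>m. \<theta> + 2 * pi / real (Suc m)) \<longlonglongrightarrow> \<theta> + 0"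
    by (intro tendsto_intros)
  then have lim: "\<phi> \<longlonglongrightarrow> \<theta>"
    by (intro tendsto_sandwich[of "\<lambda>_. \<theta>" \<phi> _ "\<lambda>m. \<theta> + 2 * pi / real (Suc m)"])
       (simp_all add: always_eventually less_imp_le[OF lower] upper del: of_nat_Suc)
  then have "(\<lambda>m. complex_of_real (2 + 2 * cos (\<phi> m))) \<longlonglongrightarrow> complex_of_real (2 + 2 * cos \<theta>)"
    by (intro tendsto_intros)
  also have "2 + 2 * cos \<theta> = c"
    by (simp add: cos_\<theta> field_simps)
  finally have "\<forall>\<^sub>F m in sequentially. dist (complex_of_real (2 + 2 * cos (\<phi> m))) (of_real c) < e"
    using e by (rule tendstoD)
  moreover have "\<forall>\<^sub>F m in sequentially. \<phi> m < 2 * pi"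
    using \<theta> pi_gt_zero by (intro order_tendstoD(2)[OF lim]) linarith
  ultimately show ?thesis
  proof eventually_elim
    case (elim m)
    let ?r = "cis (\<phi> m)"
    have "real (Suc m) * \<phi> m = 2 * pi * real_of_int (k m)"
      by (simp add: \<phi>_def del: of_nat_Suc)
    then have one: "?r ^ Suc m = 1"
      by (simp only: Complex.DeMoivre) simp
    have ne: "?r \<noteq> 1"
    proof
      assume "?r = 1"
      then have "cos (\<phi> m) = 1"
        by (simp add: complex_eq_iff)
      then obtain j :: int where j: "\<phi> m = of_int j * 2 * pi"
        by (auto simp: cos_one_2pi_int)
      have "0 < \<phi> m"
        using lower[of m] \<theta> by linarith
      then have "0 < j"
        unfolding j by (simp add: zero_less_mult_iff)
      moreover have "j < 1"
        using elim(2) unfolding j by simp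
      ultimately show False
        by linarith
    qed
    have "2 + ?r + inverse ?r = complex_of_real (2 + 2 * cos (\<phi> m))"
      by (simp add: complex_eq_iff)
    with elim(1) have "dist (complex_of_real c) (2 + ?r + inverse ?r) < e"
      by (simp only: dist_commute)
    with one ne show ?case
      by blast
  qed
qed

text \<open>
  The open mapping theorem, where constancy of the quotient on a small ball would give the
  polynomial \<open>B\<^sup>2 - c A\<close> infinitely many roots.
\<close>

lemma quotient_image_contains_ball:
  fixes A B :: "complex poly"
  assumes A: "poly A p \<noteq> 0" and U: "open U" "p \<in> U"
    and nonconst: "B\<^sup>2 \<noteq> smult ((poly B p)\<^sup>2 / poly A p) A"
  obtains e where "0 < e"
    "ball ((poly B p)\<^sup>2 / poly A p) e \<subseteq> (\<lambda>z. (poly B z)\<^sup>2 / poly A z) ` (U \<inter> {z. poly A z \<noteq> 0})"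
proof -
  define f where "f z = (poly B z)\<^sup>2 / poly A z" for z
  define V where "V = U \<inter> {z. poly A z \<noteq> 0}"
  have "open {z. poly A z \<noteq> 0}"
    by (intro open_Collect_neq continuous_intros)
  then have "open V"
    unfolding V_def using U by blast
  moreover have "p \<in> V"
    using A U by (simp add: V_def)
  ultimately obtain d where d: "0 < d" "ball p d \<subseteq> V"
    by (meson openE)
  have "\<not> f constant_on ball p d"
  proof
    assume "f constant_on ball p d"
    then have const: "f z = f p" if "z \<in> ball p d" for z
      using that d(1) unfolding constant_on_def by (metis centre_in_ball)
    have "ball p d \<subseteq> {z. poly (B\<^sup>2 - smult (f p) A) z = 0}"
    proof
      fix z assume z: "z \<in> ball p d"
      then have "poly A z \<noteq> 0"
        using d(2) by (auto simp: V_def)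
      then show "z \<in> {z. poly (B\<^sup>2 - smult (f p) A) z = 0}"
        using const[OF z] by (simp add: f_def[of z] divide_eq_eq)
    qed
    moreover have "B\<^sup>2 - smult (f p) A \<noteq> 0"
      using nonconst by (simp add: f_def)
    ultimately have "finite (ball p d)"
      using poly_roots_finite finite_subset by blast
    then show False
      using uncountable_ball[OF d(1), of p] countable_finite by blast
  qed
  moreover have "f holomorphic_on ball p d"
    unfolding f_def using d(2) by (auto intro!: holomorphic_intros simp: V_def)
  ultimately have "open (f ` ball p d)"
    by (intro open_mapping_thm[of f "ball p d" "ball p d"]) auto
  moreover have "f p \<in> f ` ball p d"
    using d(1) by simp
  ultimately obtain e where "0 < e" "ball (f p) e \<subseteq> f ` ball p d"
    by (meson openE)
  then have "0 < e" "ball (f p) e \<subseteq> f ` V"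
    using d(2) by blast+
  then show thesis
    using that[of e] by (simp add: f_def V_def)
qed

theorem theorem1:
  fixes A B :: "complex poly" and H :: "nat \<Rightarrow> complex poly"
  assumes "has_generating_function H A B"
  shows "(\<forall>m z. poly (H m) z = 0 \<and> poly A z \<noteq> 0 \<longrightarrow> z \<in> C2 A B) \<and>
         (\<not> degenerate A B \<longrightarrow>
           (\<forall>p \<in> C2 A B. \<forall>U. open U \<and> p \<in> U \<longrightarrow>
             (\<forall>\<^sub>F m in sequentially. \<exists>z \<in> U. poly (H m) z = 0 \<and> poly A z \<noteq> 0)))"
proof (intro conjI impI allI ballI)
  fix m z assume z: "poly (H m) z = 0 \<and> poly A z \<noteq> 0"
  then obtain r where "r ^ Suc m = 1" "(poly B z)\<^sup>2 / poly A z = 2 + r + inverse r"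
    using generating_function_zero_iff[OF assms] by blast
  then show "z \<in> C2 A B"
    using two_plus_root_of_unity_real[of r m] z by (simp only: C2_def mem_Collect_eq) blast
next
  fix p U assume nondeg: "\<not> degenerate A B" and p: "p \<in> C2 A B" and U: "open U \<and> p \<in> U"
  define c where "c = Re ((poly B p)\<^sup>2 / poly A p)"
  have Ap: "poly A p \<noteq> 0" and c: "0 \<le> c" "c \<le> 4"
    and quot: "(poly B p)\<^sup>2 / poly A p = complex_of_real c"
    using p by (simp_all add: C2_def c_def complex_eq_iff)
  have "B\<^sup>2 \<noteq> smult ((poly B p)\<^sup>2 / poly A p) A"
    using nondeg Ap c unfolding degenerate_def quot by force
  then obtain e where e: "0 < e"
    "ball (complex_of_real c) e \<subseteq> (\<lambda>z. (poly B z)\<^sup>2 / poly A z) ` (U \<inter> {z. poly A z \<noteq> 0})"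
    using quotient_image_contains_ball[OF Ap, of U B] U unfolding quot by blast
  show "\<forall>\<^sub>F m in sequentially. \<exists>z\<in>U. poly (H m) z = 0 \<and> poly A z \<noteq> 0"
    using root_of_unity_values_dense[OF c e(1)]
  proof eventually_elim
    case (elim m)
    then obtain r where r: "r ^ Suc m = 1" "r \<noteq> 1"
      "2 + r + inverse r \<in> ball (complex_of_real c) e"
      by auto
    then obtain z where z: "z \<in> U" "poly A z \<noteq> 0"
      "2 + r + inverse r = (poly B z)\<^sup>2 / poly A z"
      using e(2) by blast
    then have "poly (H m) z = 0"
      using generating_function_zero_iff[OF assms z(2)] r by metis
    with z show ?case
      by blast
  qed
qed

end
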